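(* Let $M$ be a loopfree matroid on a finite set $E(M)=\{0,1,\ldots,n\}$ and let $\mathfrak{B}(M)$ be its Bergman fan in $\mathbb{R}^{n+1}/\mathbb{R}\cdot\mathbf{1}$. Then distinct maximal cones of $\mathfrak{B}(M)$ span distinct linear subspaces of $\mathbb{R}^{n+1}/\mathbb{R}\cdot\mathbf{1}$.
   Context: $\mathbf{1}=(1,\ldots,1)\in\mathbb{R}^{n+1}$ and $\{e_0,\ldots,e_n\}$ is the standard basis of $\mathbb{R}^{n+1}$. A matroid is loopfree if every element lies in some basis. Let $\mathcal{B}(M)$ be the set of bases of $M$; for $B\subset E(M)$ put $e_B=\sum_{i\in B}e_i$, and let $P_M=\operatorname{conv}(e_B: B\in\mathcal{B}(M))\subset\mathbb{R}^{n+1}$ be the matroid polytope. For a face $S$ of $P_M$, the degeneration matroid $M_S$ is the matroid on $E(M)$ whose independent sets are the subsets $I$ such that $I\subset B$ for some $B\in\mathcal{B}(M)$ with $e_B$ a vertex of $S$. Let $\sigma_S\subset\mathbb{R}^{n+1}/\mathbb{R}\cdot\mathbf{1}$ be the closure of the set of classes of vectors $u$ such that the linear functional $\langle u,\cdot\rangle$ attains its maximum on $P_M$ exactly on the face $S$. The Bergman fan $\mathfrak{B}(M)$ is the collection of all cones $\sigma_S$ such that $M_S$ is loopfree (i.e. the union of the bases of $M_S$ is $E(M)$). Cones are not required to be strongly convex (if $M$ is not connected there is a nontrivial lineality space). A maximal cone is one that is maximal with respect to inclusion. *)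

theory Defs
  imports "HOL-Analysis.Analysis"
begin

section \<open>Matroids\<close>

text \<open>A matroid is given by its ground set and its family of independent sets.\<close>

definition matroid :: "'a set \<Rightarrow> 'a set set \<Rightarrow> bool" where
  "matroid E \<I> \<longleftrightarrow>
     finite E \<and> (\<forall>I\<in>\<I>. I \<subseteq> E) \<and> {} \<in> \<I> \<and>
     (\<forall>I\<in>\<I>. \<forall>J. J \<subseteq> I \<longrightarrow> J \<in> \<I>) \<and>
     (\<forall>I\<in>\<I>. \<forall>J\<in>\<I>. card I < card J \<longrightarrow> (\<exists>x\<in>J - I. insert x I \<in> \<I>))"

definition bases :: "'a set set \<Rightarrow> 'a set set" where
  "bases \<I> = {B\<in>\<I>. \<forall>I\<in>\<I>. B \<subseteq> I \<longrightarrow> I = B}"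

definition loopfree :: "'a set \<Rightarrow> 'a set set \<Rightarrow> bool" where
  "loopfree E \<I> \<longleftrightarrow> (\<forall>x\<in>E. \<exists>B\<in>bases \<I>. x \<in> B)"


section \<open>The quotient of Euclidean space by the line through the all-ones vector\<close>

definition ones_rel :: "real ^ 'n \<Rightarrow> real ^ 'n \<Rightarrow> bool" where
  "ones_rel x y \<longleftrightarrow> (\<exists>c::real. x - y = c *\<^sub>R 1)"

lemma equivp_ones_rel: "equivp (ones_rel :: real ^ 'n \<Rightarrow> real ^ 'n \<Rightarrow> bool)"
proof (rule equivpI)
  show "reflp (ones_rel :: real ^ 'n \<Rightarrow> _)"
    by (auto simp: reflp_def ones_rel_def intro: exI[of _ 0])
  show "symp (ones_rel :: real ^ 'n \<Rightarrow> _)"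
  proof (rule sympI)
    fix x y :: "real ^ 'n"
    assume "ones_rel x y"
    then obtain c where "x - y = c *\<^sub>R 1" by (auto simp: ones_rel_def)
    then have "y - x = (- c) *\<^sub>R 1" by (simp add: algebra_simps)
    then show "ones_rel y x" unfolding ones_rel_def by blast
  qed
  show "transp (ones_rel :: real ^ 'n \<Rightarrow> _)"
  proof (rule transpI)
    fix x y z :: "real ^ 'n"
    assume "ones_rel x y" "ones_rel y z"
    then obtain c d where "x - y = c *\<^sub>R 1" "y - z = d *\<^sub>R 1"
      by (auto simp: ones_rel_def)
    then have "x - z = (c + d) *\<^sub>R 1" by (simp add: algebra_simps)
    then show "ones_rel x z" unfolding ones_rel_def by blast
  qed
qed

quotient_type (overloaded) 'n mod_ones = "real ^ 'n::finite" / ones_rel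
  morphisms rep_mod_ones mod_ones_class
  by (rule equivp_ones_rel)

instantiation mod_ones :: (finite) real_vector
begin

lift_definition zero_mod_ones :: "'a mod_ones" is 0 .

lift_definition plus_mod_ones :: "'a mod_ones \<Rightarrow> 'a mod_ones \<Rightarrow> 'a mod_ones" is "(+)"
proof -
  fix x x' y y' :: "real ^ 'a"
  assume "ones_rel x x'" "ones_rel y y'"
  then obtain c d where "x - x' = c *\<^sub>R 1" "y - y' = d *\<^sub>R 1"
    by (auto simp: ones_rel_def)
  then have "(x + y) - (x' + y') = (c + d) *\<^sub>R 1" by (simp add: algebra_simps)
  then show "ones_rel (x + y) (x' + y')" unfolding ones_rel_def by blast
qed

lift_definition uminus_mod_ones :: "'a mod_ones \<Rightarrow> 'a mod_ones" is uminus
proof -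
  fix x x' :: "real ^ 'a"
  assume "ones_rel x x'"
  then obtain c where "x - x' = c *\<^sub>R 1"
    by (auto simp: ones_rel_def)
  then have "(- x) - (- x') = (- c) *\<^sub>R 1" by (simp add: algebra_simps)
  then show "ones_rel (- x) (- x')" unfolding ones_rel_def by blast
qed

lift_definition minus_mod_ones :: "'a mod_ones \<Rightarrow> 'a mod_ones \<Rightarrow> 'a mod_ones" is "(-)"
proof -
  fix x x' y y' :: "real ^ 'a"
  assume "ones_rel x x'" "ones_rel y y'"
  then obtain c d where "x - x' = c *\<^sub>R 1" "y - y' = d *\<^sub>R 1"
    by (auto simp: ones_rel_def)
  then have "(x - y) - (x' - y') = (c - d) *\<^sub>R 1" by (simp add: algebra_simps)
  then show "ones_rel (x - y) (x' - y')" unfolding ones_rel_def by blast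
qed

lift_definition scaleR_mod_ones :: "real \<Rightarrow> 'a mod_ones \<Rightarrow> 'a mod_ones" is scaleR
proof -
  fix r :: real and x x' :: "real ^ 'a"
  assume "ones_rel x x'"
  then obtain c where "x - x' = c *\<^sub>R 1"
    by (auto simp: ones_rel_def)
  then have "r *\<^sub>R x - r *\<^sub>R x' = (r * c) *\<^sub>R 1"
    by (simp flip: scaleR_right_diff_distrib)
  then show "ones_rel (r *\<^sub>R x) (r *\<^sub>R x')" unfolding ones_rel_def by blast
qed

instance
proof
  note refl = equivp_reflp[OF equivp_ones_rel]
  fix a b :: real and x y z :: "'a mod_ones"
  show "x + y + z = x + (y + z)" by transfer (simp add: add.assoc refl)
  show "x + y = y + x" by transfer (simp add: add.commute refl)
  show "0 + x = x" by transfer (simp add: refl)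
  show "- x + x = 0" by transfer (simp add: refl)
  show "x - y = x + - y" by transfer (simp add: refl)
  show "a *\<^sub>R (x + y) = a *\<^sub>R x + a *\<^sub>R y"
    by transfer (simp add: scaleR_right_distrib refl)
  show "(a + b) *\<^sub>R x = a *\<^sub>R x + b *\<^sub>R x"
    by transfer (simp add: scaleR_left_distrib refl)
  show "a *\<^sub>R b *\<^sub>R x = (a * b) *\<^sub>R x" by transfer (simp add: refl)
  show "1 *\<^sub>R x = x" by transfer (simp add: refl)
qed

end

instantiation mod_ones :: (finite) topological_space
begin

definition open_mod_ones :: "'a mod_ones set \<Rightarrow> bool" where
  "open_mod_ones U \<longleftrightarrow> open (mod_ones_class -` U)"

instance
  by standard (auto simp: open_mod_ones_def vimage_Union)

end


section \<open>The matroid polytope and the Bergman fan\<close>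

text \<open>From here on the ground set is the whole (finite) index type \<open>'n\<close>, so that the
  coordinates of \<^typ>\<open>real ^ 'n\<close> are indexed by the elements of the matroid.\<close>

definition indicator_vec :: "'n set \<Rightarrow> real ^ 'n::finite" where
  "indicator_vec B = (\<Sum>i\<in>B. axis i 1)"

definition matroid_polytope :: "'n set set \<Rightarrow> (real ^ 'n::finite) set" where
  "matroid_polytope \<I> = convex hull (indicator_vec ` bases \<I>)"

text \<open>The vertices of a polytope are its extreme points.\<close>

definition degeneration :: "'n set set \<Rightarrow> (real ^ 'n::finite) set \<Rightarrow> 'n set set" where
  "degeneration \<I> S =
     {I. \<exists>B\<in>bases \<I>. indicator_vec B extreme_point_of S \<and> I \<subseteq> B}"

definition maximizers :: "(real ^ 'n) set \<Rightarrow> real ^ 'n::finite \<Rightarrow> (real ^ 'n) set" where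
  "maximizers P u = {x\<in>P. \<forall>y\<in>P. u \<bullet> y \<le> u \<bullet> x}"

definition face_cone :: "'n set set \<Rightarrow> (real ^ 'n::finite) set \<Rightarrow> 'n mod_ones set" where
  "face_cone \<I> S = closure (mod_ones_class ` {u. maximizers (matroid_polytope \<I>) u = S})"

text \<open>The library notion of face admits the empty face; it contributes no cone, because its
  degeneration has no bases and the index type is nonempty.\<close>

definition bergman_fan :: "'n::finite set set \<Rightarrow> 'n mod_ones set set" where
  "bergman_fan \<I> =
     {face_cone \<I> S | S. S face_of matroid_polytope \<I> \<and> loopfree UNIV (degeneration \<I> S)}"

definition maximal_cones :: "'n::finite set set \<Rightarrow> 'n mod_ones set set" where
  "maximal_cones \<I> = {C\<in>bergman_fan \<I>. \<forall>D\<in>bergman_fan \<I>. C \<subseteq> D \<longrightarrow> D = C}"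

end

theory Submission
  imports Defs
begin

text \<open>
  Let \<open>u\<close> be a weight such that every element lies in a \<open>u\<close>-maximal basis, and fix one such
  basis \<open>B\<close>. Order \<open>B\<close> injectively by \<open>g\<close> in a way that refines \<open>u\<close>, and give every element
  \<open>x\<close> the least \<open>g\<close>-value on its fundamental circuit with respect to \<open>B\<close>. The bases maximal for
  the resulting weight \<open>h\<close> are precisely the transversals of the fibres of \<open>h\<close>, and they are all
  \<open>u\<close>-maximal. So every cone of the Bergman fan lies in the cone of such an \<open>h\<close>, and a maximal
  cone is the cone of some \<open>h\<close>. The span of that cone consists of the classes that are constant
  on the fibres of \<open>h\<close>. Hence the span determines the fibres, thus the maximal bases, thus the
  face and the cone.
\<close>

section \<open>Maximum-weight bases\<close>

lemma matroid_finite: "matroid E \<I> \<Longrightarrow> finite E"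
  by (simp add: matroid_def)

lemma matroid_subset: "matroid E \<I> \<Longrightarrow> I \<in> \<I> \<Longrightarrow> I \<subseteq> E"
  by (simp add: matroid_def)

lemma matroid_indep_finite: "matroid E \<I> \<Longrightarrow> I \<in> \<I> \<Longrightarrow> finite I"
  by (meson finite_subset matroid_finite matroid_subset)

lemma matroid_empty: "matroid E \<I> \<Longrightarrow> {} \<in> \<I>"
  by (simp add: matroid_def)

lemma matroid_mono: "matroid E \<I> \<Longrightarrow> I \<in> \<I> \<Longrightarrow> J \<subseteq> I \<Longrightarrow> J \<in> \<I>"
  unfolding matroid_def by blast

lemma matroid_augment:
  assumes "matroid E \<I>" "I \<in> \<I>" "J \<in> \<I>" "card I < card J"
  obtains x where "x \<in> J - I" "insert x I \<in> \<I>"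
  using assms unfolding matroid_def by blast

lemma bases_indep: "B \<in> bases \<I> \<Longrightarrow> B \<in> \<I>"
  by (simp add: bases_def)

lemma card_indep_le_basis:
  assumes "matroid E \<I>" "B \<in> bases \<I>" "I \<in> \<I>"
  shows "card I \<le> card B"
proof (rule ccontr)
  assume "\<not> card I \<le> card B"
  then obtain x where "x \<in> I - B" "insert x B \<in> \<I>"
    using matroid_augment[OF assms(1) bases_indep[OF assms(2)] assms(3)] by force
  then show False
    using assms(2) unfolding bases_def by blast
qed

lemma basis_if_card:
  assumes "matroid E \<I>" "B \<in> bases \<I>" "I \<in> \<I>" "card B \<le> card I"
  shows "I \<in> bases \<I>"
  unfolding bases_def
proof (intro CollectI conjI ballI impI)
  fix J assume "J \<in> \<I>" "I \<subseteq> J"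
  then have "card J \<le> card I"
    using card_indep_le_basis[OF assms(1,2)] assms(4) by force
  then show "J = I"
    using \<open>I \<subseteq> J\<close> card_seteq matroid_indep_finite[OF assms(1) \<open>J \<in> \<I>\<close>] by blast
qed (fact assms)

lemma matroid_extend:
  assumes "matroid E \<I>" "I \<in> \<I>" "J \<in> \<I>" "card I \<le> card J"
  shows "\<exists>K\<in>\<I>. I \<subseteq> K \<and> K \<subseteq> I \<union> J \<and> card K = card J"
  using assms(2,4)
proof (induction "card J - card I" arbitrary: I)
  case 0
  then show ?case by (intro bexI[of _ I]) auto
next
  case (Suc n)
  then have "card I < card J" by simp
  then obtain x where x: "x \<in> J - I" "insert x I \<in> \<I>"
    using matroid_augment[OF assms(1) Suc.prems(1) assms(3)] by blast
  have "card (insert x I) = Suc (card I)"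
    using x matroid_indep_finite[OF assms(1) Suc.prems(1)] by simp
  then have "\<exists>K\<in>\<I>. insert x I \<subseteq> K \<and> K \<subseteq> insert x I \<union> J \<and> card K = card J"
    using Suc x \<open>card I < card J\<close> by (intro Suc.hyps(1)) auto
  then show ?case using x by blast
qed

text \<open>\<open>insert x J\<close> extends within \<open>insert x B\<close> to an independent set
  as large as \<open>B\<close>, which omits a single element of \<open>insert x B\<close>, lying in
  \<open>B - J\<close>. So an exchange can protect a prescribed part \<open>J\<close> of
  \<open>B\<close>.\<close>

lemma basis_exchange:
  assumes M: "matroid E \<I>" and B: "B \<in> bases \<I>" and J: "J \<subseteq> B" "x \<notin> J" "insert x J \<in> \<I>"
  shows "\<exists>b\<in>B - J. insert x (B - {b}) \<in> bases \<I>"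
proof (cases "x \<in> B")
  case True
  then show ?thesis
    using J B by (intro bexI[of _ x]) (auto simp: insert_absorb)
next
  case False
  have finB: "finite B" using M B bases_indep matroid_indep_finite by blast
  obtain K where K: "K \<in> \<I>" "insert x J \<subseteq> K" "K \<subseteq> insert x J \<union> B" "card K = card B"
    using matroid_extend[OF M J(3) bases_indep[OF B] card_indep_le_basis[OF M B J(3)]] by blast
  have "card (insert x B - K) = 1"
    using K J False finB by (subst card_Diff_subset) (auto intro: finite_subset)
  then obtain b where b: "insert x B - K = {b}" by (meson card_1_singletonE)
  then have bB: "b \<in> B" "b \<notin> J" "b \<noteq> x" using K by blast+
  have "K = insert x (B - {b})" using b K J bB by blast
  moreover have "K \<in> bases \<I>" using basis_if_card[OF M B K(1)] K(4) by simp
  ultimately show ?thesis using bB by blast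
qed

section \<open>Greedy properties of bases of maximal weight\<close>

definition max_bases :: "'a set set \<Rightarrow> ('a \<Rightarrow> real) \<Rightarrow> 'a set set" where
  "max_bases \<I> u = {B\<in>bases \<I>. \<forall>B'\<in>bases \<I>. sum u B' \<le> sum u B}"

lemma max_basesD: "B \<in> max_bases \<I> u \<Longrightarrow> B \<in> bases \<I>"
  by (simp add: max_bases_def)

lemma sum_exchange:
  fixes u :: "'a \<Rightarrow> real"
  assumes "finite B" "b \<in> B" "x \<notin> B \<or> x = b"
  shows "sum u (insert x (B - {b})) = sum u B - u b + u x"
  using assms by (auto simp: sum.remove[of B b] insert_absorb)

lemma max_bases_exchange_le:
  assumes "matroid E \<I>" "B \<in> max_bases \<I> u" "b \<in> B" "insert x (B - {b}) \<in> bases \<I>"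
  shows "u x \<le> u b"
proof (cases "x \<in> B \<and> x \<noteq> b")
  case True
  then have "insert x (B - {b}) \<subset> B" using assms(3) by auto
  moreover have "B \<in> \<I>" using assms(2) by (simp add: max_bases_def bases_def)
  ultimately show ?thesis using assms(4) unfolding bases_def by blast
next
  case False
  have "finite B"
    using assms(1,2) bases_indep matroid_indep_finite max_basesD by blast
  then have "sum u (insert x (B - {b})) = sum u B - u b + u x"
    using False assms(3) by (intro sum_exchange) auto
  then show ?thesis using assms(2,4) by (force simp: max_bases_def)
qed

text \<open>Greedy optimality: a larger \<open>J\<close> would augment the upper level set of
  \<open>B\<close> by an element heavier than \<open>c\<close>, and an exchange protecting that
  level set would trade an element of weight at most \<open>c\<close> for it.\<close>

lemma max_bases_level_card:
  assumes M: "matroid E \<I>" and B: "B \<in> max_bases \<I> u" and J: "J \<in> \<I>" "\<And>y. y \<in> J \<Longrightarrow> c < u y"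
  shows "card J \<le> card {b\<in>B. c < u b}"
proof (rule ccontr)
  assume "\<not> ?thesis"
  then have less: "card {b\<in>B. c < u b} < card J" by simp
  have "{b\<in>B. c < u b} \<in> \<I>"
    by (rule matroid_mono[OF M bases_indep[OF max_basesD[OF B]]]) blast
  then obtain y where y: "y \<in> J - {b\<in>B. c < u b}" "insert y {b\<in>B. c < u b} \<in> \<I>"
    using matroid_augment[OF M _ J(1) less] by blast
  then obtain b where "b \<in> B - {b\<in>B. c < u b}" "insert y (B - {b}) \<in> bases \<I>"
    using basis_exchange[OF M max_basesD[OF B], of "{b\<in>B. c < u b}" y] by auto
  then show False
    using max_bases_exchange_le[OF M B, of b y] J(2) y by force
qed

text \<open>Maximality of \<open>B\<close> gives \<open>u x \<le> u b\<close>. If this were strict,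
  every element exchangeable for \<open>x\<close> would be heavier than \<open>x\<close>; comparing
  the parts of \<open>B\<close> and \<open>C\<close> above the weight of \<open>x\<close> refutes
  this.\<close>

lemma exchange_weight_eq:
  assumes M: "matroid E \<I>" and B: "B \<in> max_bases \<I> u" and C: "C \<in> max_bases \<I> u" "x \<in> C"
    and b: "b \<in> B" "insert x (B - {b}) \<in> bases \<I>"
    and least: "\<And>b'. b' \<in> B \<Longrightarrow> insert x (B - {b'}) \<in> bases \<I> \<Longrightarrow> u b \<le> u b'"
  shows "u x = u b"
proof (rule ccontr)
  let ?G = "\<lambda>B. {b\<in>B. u x < u b}"
  assume "u x \<noteq> u b"
  then have less: "u x < u b" using max_bases_exchange_le[OF M B b] by simp
  have indep: "?G B \<in> \<I>" "insert x (?G C) \<in> \<I>"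
    using C(2) matroid_mono[OF M bases_indep[OF max_basesD[OF B]], of "?G B"]
      matroid_mono[OF M bases_indep[OF max_basesD[OF C(1)]], of "insert x (?G C)"] by auto
  have "card (?G B) \<le> card (?G C)"
    using indep by (intro max_bases_level_card[OF M C(1)]) auto
  also have "\<dots> < card (insert x (?G C))"
    using matroid_indep_finite[OF M indep(2)] by simp
  finally obtain y where y: "y \<in> insert x (?G C) - ?G B" "insert y (?G B) \<in> \<I>"
    using matroid_augment[OF M indep] by blast
  \<comment> \<open>An element heavier than \<open>x\<close> would violate the greedy bound for
    \<open>B\<close>, so the augmenting element is \<open>x\<close> itself.\<close>
  have "\<not> u x < u y"
  proof
    assume "u x < u y"
    then have "card (insert y (?G B)) \<le> card (?G B)"
      using y by (intro max_bases_level_card[OF M B]) auto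
    moreover have "finite (?G B)" using matroid_indep_finite[OF M indep(1)] .
    ultimately show False using y by simp
  qed
  then have "insert x (?G B) \<in> \<I>" using y by auto
  then obtain b' where "b' \<in> B - ?G B" "insert x (B - {b'}) \<in> bases \<I>"
    using basis_exchange[OF M max_basesD[OF B], of "?G B" x] by auto
  then show False using least[of b'] less by force
qed


section \<open>Refining a weight to one whose maximal bases are the transversals of its fibres\<close>

text \<open>These are the bases of the partition matroid on \<open>E\<close> whose blocks are the
  fibres of \<open>h\<close>.\<close>

definition transversals :: "'a set \<Rightarrow> ('a \<Rightarrow> 'b) \<Rightarrow> 'a set set" where
  "transversals E h = {B. B \<subseteq> E \<and> (\<forall>x\<in>E. \<exists>!b. b \<in> B \<and> h b = h x)}"

text \<open>With a threshold for \<open>P\<close>, this makes corresponding level sets of any two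
  transversals equinumerous.\<close>

lemma transversal_bij_betw:
  assumes "B \<in> transversals E h"
  shows "bij_betw h {b\<in>B. P (h b)} {t\<in>h ` E. P t}"
proof -
  have "inj_on h {b\<in>B. P (h b)}"
    using assms unfolding transversals_def inj_on_def by blast
  moreover have "h ` {b\<in>B. P (h b)} = {t\<in>h ` E. P t}"
  proof (intro equalityI subsetI)
    fix t assume "t \<in> {t\<in>h ` E. P t}"
    then obtain x where "x \<in> E" "t = h x" "P (h x)" by auto
    moreover then obtain b where "b \<in> B" "h b = h x"
      using assms unfolding transversals_def by blast
    ultimately show "t \<in> h ` {b\<in>B. P (h b)}" by (metis (mono_tags, lifting) imageI mem_Collect_eq)
  qed (use assms in \<open>auto simp: transversals_def\<close>)
  ultimately show ?thesis by (simp add: bij_betw_def)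
qed

lemma transversal_card: "B \<in> transversals E h \<Longrightarrow> card B = card (h ` E)"
  using bij_betw_same_card[OF transversal_bij_betw[of B E h "\<lambda>_. True"]] by simp

text \<open>The right-hand side does not mention \<open>B\<close>, so all transversals have the same
  total weight.\<close>

lemma transversal_sum:
  assumes "B \<in> transversals E h" "\<And>x y. x \<in> E \<Longrightarrow> y \<in> E \<Longrightarrow> h x = h y \<Longrightarrow> u x = u y"
  shows "sum u B = (\<Sum>t\<in>h ` E. u (inv_into E h t))"
proof -
  have "sum u B = (\<Sum>b\<in>B. u (inv_into E h (h b)))"
  proof (rule sum.cong)
    fix b assume "b \<in> B"
    then have "b \<in> E" using assms(1) by (auto simp: transversals_def)
    then show "u b = u (inv_into E h (h b))"
      by (intro assms(2)) (auto simp: inv_into_into f_inv_into_f)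
  qed simp
  also have "\<dots> = (\<Sum>t\<in>h ` E. u (inv_into E h t))"
    using sum.reindex_bij_betw[OF transversal_bij_betw[OF assms(1), of "\<lambda>_. True"]] by simp
  finally show ?thesis .
qed

lemma transversal_through:
  assumes "x \<in> E"
  obtains B where "B \<in> transversals E h" "x \<in> B"
    "\<And>y. y \<in> E \<Longrightarrow> h y = h x \<Longrightarrow> insert y (B - {x}) \<in> transversals E h"
proof -
  \<comment> \<open>\<open>x\<close> represents its own fibre; every other fibre gets an arbitrary
    representative.\<close>
  define r where "r t = (if t = h x then x else inv_into E h t)" for t
  have r: "r t \<in> E" "h (r t) = t" if "t \<in> h ` E" for t
    using that assms by (auto simp: r_def inv_into_into f_inv_into_f)
  let ?B = "r ` h ` E"
  have B: "?B \<in> transversals E h"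
    unfolding transversals_def using r by auto
  have uniq: "a = b" if "a \<in> ?B" "b \<in> ?B" "h a = h b" for a b
    using that r by auto
  have x: "x \<in> ?B" using assms by (auto simp: r_def image_iff intro!: bexI[of _ x])
  have "insert y (?B - {x}) \<in> transversals E h" if y: "y \<in> E" "h y = h x" for y
    unfolding transversals_def
  proof (intro CollectI conjI ballI)
    fix z assume "z \<in> E"
    show "\<exists>!b. b \<in> insert y (?B - {x}) \<and> h b = h z"
    proof (cases "h z = h x")
      case True
      then show ?thesis using uniq[OF _ x] y by (intro ex1I[of _ y]) auto
    next
      case False
      have "r (h z) \<in> ?B" "h (r (h z)) = h z" using r \<open>z \<in> E\<close> by auto
      then show ?thesis using False y uniq by (intro ex1I[of _ "r (h z)"]) auto
    qed
  qed (use y r in auto)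
  with B x show thesis using that by blast
qed

text \<open>Elements are inserted in order of nondecreasing \<open>u\<close>, each receiving a value
  above all earlier ones; this also breaks ties.\<close>

lemma injective_refinement:
  fixes u :: "'a \<Rightarrow> real"
  assumes "finite B"
  shows "\<exists>g :: 'a \<Rightarrow> nat. inj_on g B \<and> (\<forall>a\<in>B. \<forall>b\<in>B. g a \<le> g b \<longrightarrow> u a \<le> u b)"
  using assms
proof (induction B rule: finite_ranking_induct[where f = u])
  case (insert x S)
  show ?case
  proof (cases "x \<in> S")
    case True
    then show ?thesis using insert.IH by (simp add: insert_absorb)
  next
    case False
    obtain g :: "'a \<Rightarrow> nat" where g: "inj_on g S" "\<forall>a\<in>S. \<forall>b\<in>S. g a \<le> g b \<longrightarrow> u a \<le> u b"
      using insert.IH by blast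
    \<comment> \<open>A sum of naturals bounds each summand, so its successor exceeds every earlier
      value.\<close>
    define g' where "g' = g(x := Suc (sum g S))"
    have "g a < g' x" if "a \<in> S" for a
      using member_le_sum[of a S g] that insert.hyps(1) by (simp add: g'_def)
    then have less: "g' a < g' x" if "a \<in> S" for a using that False by (auto simp: g'_def)
    have eq: "g' a = g a" if "a \<in> S" for a using that False by (auto simp: g'_def)
    have "inj_on g' S" using g(1) by (simp add: inj_on_def eq)
    moreover have "g' x \<notin> g' ` S" using less by (metis imageE less_irrefl)
    ultimately have "inj_on g' (insert x S)" by (simp add: False)
    moreover have "u a \<le> u b" if "a \<in> insert x S" "b \<in> insert x S" "g' a \<le> g' b" for a b
    proof (cases "a = x"; cases "b = x")
      assume "a = x" "b \<noteq> x"
      then show ?thesis using that less[of b] by simp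
    next
      assume "a \<noteq> x" "b \<noteq> x"
      then show ?thesis using that g(2) eq by simp
    qed (use that insert.hyps(2) in auto)
    ultimately show ?thesis by blast
  qed
qed simp

lemma max_bases_nonempty:
  assumes M: "matroid E \<I>" and B: "B \<in> bases \<I>"
  obtains C where "C \<in> max_bases \<I> u"
proof -
  have "bases \<I> \<subseteq> Pow E" using M by (auto simp: bases_def dest: matroid_subset)
  then have "finite (bases \<I>)" using finite_subset matroid_finite[OF M] by blast
  then have "finite (sum u ` bases \<I>)" "sum u ` bases \<I> \<noteq> {}" using B by auto
  from Max_in[OF this] obtain C where C: "C \<in> bases \<I>" "sum u C = Max (sum u ` bases \<I>)" by auto
  have "C \<in> max_bases \<I> u"
    unfolding max_bases_def using C \<open>finite (sum u ` bases \<I>)\<close> by (auto intro: Max_ge)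
  then show thesis by (rule that)
qed

lemma transversal_refinement:
  fixes u :: "'a \<Rightarrow> real"
  assumes M: "matroid E \<I>" and ne: "E \<noteq> {}"
    and loops: "\<And>x. x \<in> E \<Longrightarrow> \<exists>B\<in>max_bases \<I> u. x \<in> B"
  obtains h :: "'a \<Rightarrow> nat"
  where "max_bases \<I> (\<lambda>x. real (h x)) = transversals E h" "transversals E h \<subseteq> max_bases \<I> u"
proof -
  obtain B where B: "B \<in> max_bases \<I> u" using loops ne by blast
  note Bb = max_basesD[OF B]
  have BE: "B \<subseteq> E" using M Bb bases_indep matroid_subset by blast
  have finB: "finite B" using M Bb bases_indep matroid_indep_finite by blast
  obtain g :: "'a \<Rightarrow> nat" where g: "inj_on g B" "\<And>a b. a \<in> B \<Longrightarrow> b \<in> B \<Longrightarrow> g a \<le> g b \<Longrightarrow> u a \<le> u b"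
    using injective_refinement[OF finB, of u] by blast
  \<comment> \<open>For \<open>x \<notin> B\<close>, \<open>D x\<close> is the fundamental circuit of \<open>x\<close> without \<open>x\<close>; for \<open>x \<in> B\<close> it is \<open>{x}\<close>.\<close>
  define D where "D x = {b\<in>B. insert x (B - {b}) \<in> bases \<I>}" for x
  define h where "h x = Min (g ` D x)" for x
  have finD: "finite (g ` D x)" for x using finB by (simp add: D_def)
  have "D x \<noteq> {}" if x: "x \<in> E" for x
  proof -
    obtain C where "C \<in> max_bases \<I> u" "x \<in> C" using loops x by blast
    then have "insert x {} \<in> \<I>"
      by (intro matroid_mono[OF M bases_indep[OF max_basesD[of C \<I> u]]]) auto
    then show ?thesis using basis_exchange[OF M Bb, of "{}" x] by (auto simp: D_def)
  qed
  then have hD: "\<exists>b\<in>D x. g b = h x" if "x \<in> E" for x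
    using Min_in[OF finD, of x] that by (auto simp: h_def)
  have hle: "h x \<le> g b" if "b \<in> D x" for x b
    using that finD by (auto simp: h_def intro: Min_le)
  have DB: "D b = {b}" if "b \<in> B" for b
  proof -
    have "b' = b" if "b' \<in> B" "insert b (B - {b'}) \<in> bases \<I>" for b'
    proof (rule ccontr)
      assume "b' \<noteq> b"
      then have "insert b (B - {b'}) \<subset> B" using that \<open>b \<in> B\<close> by blast
      then show False using that(2) bases_indep[OF Bb] unfolding bases_def by blast
    qed
    then show ?thesis using that Bb by (auto simp: D_def insert_absorb)
  qed
  have hB: "h b = g b" if "b \<in> B" for b using DB[OF that] by (simp add: h_def)
  \<comment> \<open>As \<open>g\<close> refines \<open>u\<close>, the \<open>g\<close>-least element
    of \<open>D x\<close> is also \<open>u\<close>-least there, which is what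
    \<open>exchange_weight_eq\<close> asks for.\<close>
  have retract: "\<exists>b\<in>B. insert x (B - {b}) \<in> bases \<I> \<and> h b = h x \<and> u x = u b" if x: "x \<in> E" for x
  proof -
    obtain b where b: "b \<in> D x" "g b = h x" using hD[OF x] by blast
    obtain C where C: "C \<in> max_bases \<I> u" "x \<in> C" using loops x by blast
    have "u x = u b"
      using b hle g(2) by (intro exchange_weight_eq[OF M B C]) (auto simp: D_def)
    then show ?thesis using b hB by (auto simp: D_def)
  qed
  have hinj: "inj_on h B" using g(1) hB by (simp add: inj_on_def)
  have uh: "u x = u y" if "x \<in> E" "y \<in> E" "h x = h y" for x y
    using retract[OF that(1)] retract[OF that(2)] that(3) hinj by (metis inj_onD)
  have BT: "B \<in> transversals E h"
    unfolding transversals_def using BE retract hinj by (auto simp: inj_on_def) metis+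
  \<comment> \<open>The greedy bound for \<open>B\<close> and \<open>h\<close>, obtained from the
    definition of \<open>h\<close> because \<open>B\<close> is not yet known to be
    \<open>h\<close>-maximal: an element exchangeable for \<open>y\<close> has value at least
    \<open>h y\<close>.\<close>
  have level: "card J \<le> card {b\<in>B. t \<le> h b}" if J: "J \<in> \<I>" "\<And>y. y \<in> J \<Longrightarrow> t \<le> h y" for J t
  proof (rule ccontr)
    assume "\<not> ?thesis"
    then have less: "card {b\<in>B. t \<le> h b} < card J" by simp
    have "{b\<in>B. t \<le> h b} \<in> \<I>"
      by (rule matroid_mono[OF M bases_indep[OF Bb]]) blast
    then obtain y where y: "y \<in> J - {b\<in>B. t \<le> h b}" "insert y {b\<in>B. t \<le> h b} \<in> \<I>"
      using matroid_augment[OF M _ J(1) less] by blast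
    then obtain b where "b \<in> B - {b\<in>B. t \<le> h b}" "b \<in> D y"
      using basis_exchange[OF M Bb, of "{b\<in>B. t \<le> h b}" y] by (auto simp: D_def)
    then show False using hle[of b y] hB J(2) y by force
  qed
  have trans_indep: "C \<in> \<I>" if C: "C \<in> transversals E h" for C
  proof -
    have CE: "C \<subseteq> E" using C by (simp add: transversals_def)
    then have finC: "finite C" using finite_subset matroid_finite[OF M] by blast
    let ?L = "\<lambda>C t. {c\<in>C. t \<le> h c}"
    have card_eq: "card (?L C t) = card (?L B t)" for t
      using bij_betw_same_card[OF transversal_bij_betw[OF C]]
        bij_betw_same_card[OF transversal_bij_betw[OF BT]] by metis
    \<comment> \<open>\<open>N\<close> exceeds all values of \<open>h\<close> on \<open>C\<close>,
      so the downward induction over levels starts at the empty set.\<close>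
    define N where "N = Suc (sum h C)"
    have "?L C 0 \<in> \<I>"
    proof (rule inc_induct[of 0 N "\<lambda>t. ?L C t \<in> \<I>"])
      have "?L C N = {}" using member_le_sum[OF _ _ finC, of _ h] by (force simp: N_def)
      then show "?L C N \<in> \<I>" using matroid_empty[OF M] by metis
    next
      fix t assume IH: "?L C (Suc t) \<in> \<I>"
      show "?L C t \<in> \<I>"
      proof (cases "\<exists>x\<in>C. h x = t")
        case False
        then have "?L C t = ?L C (Suc t)" by (metis Suc_leD not_less_eq_eq order_antisym)
        then show ?thesis using IH by simp
      next
        case True
        then obtain x where x: "x \<in> C" "h x = t" by blast
        then have "x \<in> E" using CE by blast
        have Ct: "?L C t = insert x (?L C (Suc t))"
          using x C \<open>x \<in> E\<close> unfolding transversals_def by (auto simp: Suc_le_eq) (metis le_neq_implies_less)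
        obtain b where b: "b \<in> B" "insert x (B - {b}) \<in> bases \<I>" "h b = t"
          using retract[OF \<open>x \<in> E\<close>] x by blast
        \<comment> \<open>Since \<open>h b = t\<close>, removing \<open>b\<close> leaves the part of
          \<open>B\<close> above level \<open>t\<close> intact.\<close>
        have K: "insert x (?L B (Suc t)) \<in> \<I>"
          using b by (intro matroid_mono[OF M bases_indep[OF b(2)]]) auto
        have "card (?L C (Suc t)) < card (insert x (?L B (Suc t)))"
          unfolding card_eq using finB x by simp
        then obtain y where y: "y \<in> insert x (?L B (Suc t)) - ?L C (Suc t)"
          "insert y (?L C (Suc t)) \<in> \<I>"
          using matroid_augment[OF M IH K] by blast
        \<comment> \<open>The parts of \<open>B\<close> and \<open>C\<close> above level
          \<open>t\<close> are equinumerous, so adding another element there would violate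
          \<open>level\<close>. Hence \<open>y\<close> is \<open>x\<close>.\<close>
        have "\<not> Suc t \<le> h y"
        proof
          assume "Suc t \<le> h y"
          then have "card (insert y (?L C (Suc t))) \<le> card (?L B (Suc t))"
            using y by (intro level) auto
          moreover have "card (insert y (?L C (Suc t))) = Suc (card (?L C (Suc t)))"
            using y finC by simp
          ultimately show False using card_eq by simp
        qed
        then show ?thesis using y Ct by auto
      qed
    qed simp
    then show ?thesis by simp
  qed
  have trans_basis: "C \<in> bases \<I>" if C: "C \<in> transversals E h" for C
    using basis_if_card[OF M Bb trans_indep[OF C]] transversal_card[OF C] transversal_card[OF BT]
    by (metis order_refl)
  have max_trans: "C \<in> transversals E h" if C: "C \<in> max_bases \<I> (\<lambda>x. real (h x))" for C
  proof -
    have Ci: "C \<in> \<I>" using bases_indep[OF max_basesD[OF C]] .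
    have CE: "C \<subseteq> E" using M Ci by (rule matroid_subset)
    have finC: "finite C" using M Ci by (rule matroid_indep_finite)
    have lev: "card {c\<in>C. t \<le> h c} = card {b\<in>B. t \<le> h b}" for t
    proof (rule antisym)
      have "{b\<in>B. t \<le> h b} \<in> \<I>" using matroid_mono[OF M bases_indep[OF Bb]] by simp
      \<comment> \<open>The greedy bound uses a strict inequality, hence the shift of the integral
        threshold by one.\<close>
      then have "card {b\<in>B. t \<le> h b} \<le> card {c\<in>C. real t - 1 < real (h c)}"
        by (intro max_bases_level_card[OF M C]) auto
      also have "{c\<in>C. real t - 1 < real (h c)} = {c\<in>C. t \<le> h c}"
        by auto
      finally show "card {b\<in>B. t \<le> h b} \<le> card {c\<in>C. t \<le> h c}" .
    qed (use matroid_mono[OF M Ci] in \<open>auto intro!: level\<close>)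
    \<comment> \<open>Consecutive level sets are nested, so the level counts determine the fibre
      sizes.\<close>
    have fib: "card {c\<in>C. h c = t} = card {c\<in>C. t \<le> h c} - card {c\<in>C. Suc t \<le> h c}"
      if "finite C" for C t
      using that by (subst card_Diff_subset[symmetric]) (auto intro!: arg_cong[of _ _ card])
    have "\<exists>!c. c \<in> C \<and> h c = h x" if x: "x \<in> E" for x
    proof -
      obtain b where "b \<in> B" "h b = h x" using retract[OF x] by blast
      then have "{b\<in>B. h b = h x} = {b}" using hinj by (auto simp: inj_on_def)
      moreover have "card {c\<in>C. h c = h x} = card {b\<in>B. h b = h x}"
        by (simp only: fib[OF finB] fib[OF finC] lev)
      ultimately have "card {c\<in>C. h c = h x} = 1" by simp
      then obtain c where "{c\<in>C. h c = h x} = {c}" by (meson card_1_singletonE)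
      then show ?thesis by (intro ex1I[of _ c]) blast+
    qed
    then show ?thesis using CE by (simp add: transversals_def)
  qed
  \<comment> \<open>All transversals have equal weight under \<open>v\<close>, so one maximal
    transversal makes them all maximal. This serves for \<open>h\<close> and, starting from
    \<open>B\<close>, for \<open>u\<close>.\<close>
  have max_eq: "C \<in> max_bases \<I> v"
    if C: "C \<in> transversals E h" and C': "C' \<in> max_bases \<I> v" "C' \<in> transversals E h"
      and v: "\<And>x y. x \<in> E \<Longrightarrow> y \<in> E \<Longrightarrow> h x = h y \<Longrightarrow> v x = v y" for C C' v
  proof -
    have "sum v C = (\<Sum>t\<in>h ` E. v (inv_into E h t))" by (intro transversal_sum C v)
    also have "\<dots> = sum v C'" by (intro transversal_sum[symmetric] C' v)
    finally show ?thesis using C'(1) trans_basis[OF C] by (simp add: max_bases_def)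
  qed
  obtain C' where C': "C' \<in> max_bases \<I> (\<lambda>x. real (h x))" by (rule max_bases_nonempty[OF M Bb])
  have "max_bases \<I> (\<lambda>x. real (h x)) = transversals E h"
    using max_trans max_eq[OF _ C' max_trans[OF C']] by auto
  moreover have "transversals E h \<subseteq> max_bases \<I> u"
    using max_eq[OF _ B BT] uh by blast
  ultimately show thesis by (rule that)
qed


section \<open>Faces of the matroid polytope\<close>

lemma indicator_vec_nth: "indicator_vec B $ i = (if i \<in> B then 1 else 0)"
  by (simp add: indicator_vec_def axis_def if_distrib sum.delta cong: if_cong)

lemma inner_indicator_vec: "u \<bullet> indicator_vec B = sum (($) u) B"
  by (simp add: indicator_vec_def inner_sum_right inner_axis)

text \<open>A halfspace contains a hull as soon as it contains the generators, so bounds on the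
  polytope are bounds on bases.\<close>

lemma indicator_vec_maximizers_iff:
  assumes "B \<in> bases \<I>"
  shows "indicator_vec B \<in> maximizers (matroid_polytope \<I>) u \<longleftrightarrow> B \<in> max_bases \<I> (($) u)"
proof -
  have "(\<forall>y\<in>matroid_polytope \<I>. u \<bullet> y \<le> c) \<longleftrightarrow> (\<forall>B\<in>bases \<I>. sum (($) u) B \<le> c)" for c
  proof
    assume "\<forall>B\<in>bases \<I>. sum (($) u) B \<le> c"
    then have "matroid_polytope \<I> \<subseteq> {y. u \<bullet> y \<le> c}"
      unfolding matroid_polytope_def
      by (intro hull_minimal convex_halfspace_le) (auto simp: inner_indicator_vec)
    then show "\<forall>y\<in>matroid_polytope \<I>. u \<bullet> y \<le> c" by blast
  next
    assume *: "\<forall>y\<in>matroid_polytope \<I>. u \<bullet> y \<le> c"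
    have "indicator_vec B \<in> matroid_polytope \<I>" if "B \<in> bases \<I>" for B
      using that by (simp add: matroid_polytope_def hull_inc)
    with * show "\<forall>B\<in>bases \<I>. sum (($) u) B \<le> c" by (metis inner_indicator_vec)
  qed
  moreover have "indicator_vec B \<in> matroid_polytope \<I>"
    using assms by (simp add: matroid_polytope_def hull_inc)
  ultimately show ?thesis
    using assms by (simp add: maximizers_def max_bases_def inner_indicator_vec)
qed

lemma maximizers_face_of:
  assumes "convex P"
  shows "maximizers P u face_of P"
proof (cases "maximizers P u = {}")
  case False
  then obtain x where x: "x \<in> P" "\<forall>y\<in>P. u \<bullet> y \<le> u \<bullet> x" by (auto simp: maximizers_def)
  have "maximizers P u = P \<inter> {y. u \<bullet> y = u \<bullet> x}"
    using x by (auto simp: maximizers_def intro: antisym)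
  then show ?thesis
    using face_of_Int_supporting_hyperplane_le[OF assms] x(2) by simp
qed simp

text \<open>A face of the hull of finitely many points is the hull of some of them; those lying in
  this face come from the maximal bases.\<close>

lemma maximizers_eq_hull:
  "maximizers (matroid_polytope \<I>) u = convex hull (indicator_vec ` max_bases \<I> (($) u))"
proof -
  let ?F = "maximizers (matroid_polytope \<I>) u"
  have face: "?F face_of convex hull (indicator_vec ` bases \<I>)"
    using maximizers_face_of[of "matroid_polytope \<I>" u] by (simp add: matroid_polytope_def)
  have "compact (indicator_vec ` bases \<I>)" by (simp add: finite_imp_compact)
  then obtain V where V: "V \<subseteq> indicator_vec ` bases \<I>" "?F = convex hull V"
    using face_of_convex_hull_subset[OF _ face] by blast
  have "V \<subseteq> ?F" using V hull_subset by metis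
  then have "V \<subseteq> indicator_vec ` max_bases \<I> (($) u)"
    using V(1) indicator_vec_maximizers_iff by blast
  moreover have "indicator_vec ` max_bases \<I> (($) u) \<subseteq> ?F"
    using indicator_vec_maximizers_iff max_basesD by blast
  moreover have "convex ?F" using V by simp
  ultimately show ?thesis using V(2) by (metis antisym hull_minimal hull_mono)
qed

lemma maximizers_eq_iff:
  "maximizers (matroid_polytope \<I>) u = maximizers (matroid_polytope \<I>) v \<longleftrightarrow>
     max_bases \<I> (($) u) = max_bases \<I> (($) v)"
proof
  assume "maximizers (matroid_polytope \<I>) u = maximizers (matroid_polytope \<I>) v"
  then show "max_bases \<I> (($) u) = max_bases \<I> (($) v)"
    using indicator_vec_maximizers_iff max_basesD by blast
qed (simp add: maximizers_eq_hull)

text \<open>\<open>S\<close> lies in the unit cube, and a 0/1 vector is a vertex of the cube: in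
  each coordinate two nonnegative terms sum to zero, so both vanish.\<close>

lemma indicator_vec_extreme:
  fixes S :: "(real ^ 'n::finite) set"
  assumes "indicator_vec B \<in> S" "S \<subseteq> convex hull (range indicator_vec)"
  shows "indicator_vec B extreme_point_of S"
proof -
  have "{x :: real^'n. \<forall>i. 0 \<le> x $ i \<and> x $ i \<le> 1} = cbox 0 1"
    by (auto simp: mem_box_cart)
  then have cube: "convex {x :: real^'n. \<forall>i. 0 \<le> x $ i \<and> x $ i \<le> 1}" by (metis convex_box(1))
  have "convex hull (range indicator_vec) \<subseteq> {x :: real^'n. \<forall>i. 0 \<le> x $ i \<and> x $ i \<le> 1}"
    by (intro hull_minimal cube) (auto simp: indicator_vec_nth)
  then have S: "0 \<le> x $ i" "x $ i \<le> 1" if "x \<in> S" for x i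
    using assms(2) that by blast+
  have "a = b" if a: "a \<in> S" and b: "b \<in> S" and t: "0 < t" "t < 1"
    "indicator_vec B = (1 - t) *\<^sub>R a + t *\<^sub>R b" for a b :: "real^'n" and t :: real
  proof -
    have "a $ i = b $ i" for i
    proof -
      have eq: "(if i \<in> B then 1 else 0) = (1 - t) * a $ i + t * b $ i"
        using arg_cong[OF t(3), of "\<lambda>x. x $ i"] by (simp add: indicator_vec_nth)
      show ?thesis
      proof (cases "i \<in> B")
        case True
        have "(1 - t) * (1 - a $ i) + t * (1 - b $ i) = 0" using eq True by (simp add: algebra_simps)
        moreover have "0 \<le> (1 - t) * (1 - a $ i)" "0 \<le> t * (1 - b $ i)" using S a b t by auto
        ultimately have "(1 - t) * (1 - a $ i) = 0" "t * (1 - b $ i) = 0" by linarith+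
        then show ?thesis using t by simp
      next
        case False
        have "0 \<le> (1 - t) * a $ i" "0 \<le> t * b $ i" using S a b t by auto
        moreover have "(1 - t) * a $ i + t * b $ i = 0" using eq False by simp
        ultimately have "(1 - t) * a $ i = 0" "t * b $ i = 0" by linarith+
        then show ?thesis using t by simp
      qed
    qed
    then show ?thesis by (simp add: vec_eq_iff)
  qed
  then show ?thesis
    unfolding extreme_point_of_def using assms(1) by (auto simp: in_segment)
qed

text \<open>Turns loopfreeness of the degeneration into covering by maximal bases. Every maximal
  basis gives a vertex of the face, and no basis properly contains another.\<close>

lemma bases_degeneration:
  "bases (degeneration \<I> (maximizers (matroid_polytope \<I>) u)) = max_bases \<I> (($) u)"
proof -
  let ?S = "maximizers (matroid_polytope \<I>) u" and ?T = "max_bases \<I> (($) u)"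
  have "?S \<subseteq> convex hull (range indicator_vec)"
    unfolding maximizers_eq_hull by (intro hull_mono) auto
  then have "indicator_vec B extreme_point_of ?S \<longleftrightarrow> B \<in> ?T" if "B \<in> bases \<I>" for B
    using indicator_vec_extreme indicator_vec_maximizers_iff[OF that]
    by (metis extreme_point_of_def)
  then have deg: "degeneration \<I> ?S = {I. \<exists>B\<in>?T. I \<subseteq> B}"
    unfolding degeneration_def using max_basesD by blast
  have "I = B" if "B \<in> ?T" "B \<subseteq> I" "I \<subseteq> B'" "B' \<in> ?T" for B B' I
  proof -
    have "B' = B" using that max_basesD[of _ \<I> "($) u"] unfolding bases_def by blast
    then show ?thesis using that by blast
  qed
  then show ?thesis unfolding deg bases_def[of "{I. \<exists>B\<in>?T. I \<subseteq> B}"] by blast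
qed


section \<open>Spans of the cones\<close>

lemma linear_mod_ones_class: "linear mod_ones_class"
  by (intro linearI) (simp_all add: plus_mod_ones.abs_eq scaleR_mod_ones.abs_eq)

lemma continuous_mod_ones_class: "continuous_on UNIV mod_ones_class"
  by (simp add: continuous_on_open_vimage open_mod_ones_def)

text \<open>The equation is invariant under adding multiples of the all-ones vector, so it can be
  tested on any representative.\<close>

definition coord_eq :: "'n \<Rightarrow> 'n \<Rightarrow> 'n::finite mod_ones set" where
  "coord_eq x y = mod_ones_class ` {u. u $ x = u $ y}"

lemma mod_ones_class_in_coord_eq: "mod_ones_class u \<in> coord_eq x y \<longleftrightarrow> u $ x = u $ y"
proof
  assume "mod_ones_class u \<in> coord_eq x y"
  then obtain v where "v $ x = v $ y" "ones_rel u v"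
    by (auto simp: coord_eq_def mod_ones.abs_eq_iff)
  then obtain c where "u = v + c *\<^sub>R 1" by (auto simp: ones_rel_def algebra_simps)
  then show "u $ x = u $ y" using \<open>v $ x = v $ y\<close> by simp
qed (simp add: coord_eq_def)

lemma subspace_coord_eq: "subspace (coord_eq x y)"
  unfolding coord_eq_def
  by (intro linear_subspace_image linear_mod_ones_class) (simp add: subspace_def)

lemma closed_coord_eq: "closed (coord_eq x y)"
proof -
  have "mod_ones_class -` (- coord_eq x y) = {u. u $ x \<noteq> u $ y}"
    by (auto simp: mod_ones_class_in_coord_eq)
  moreover have "open {u :: real ^ 'n. u $ x \<noteq> u $ y}" for x y
    by (intro open_Collect_neq continuous_intros)
  ultimately show ?thesis by (simp add: closed_def open_mod_ones_def)
qed

text \<open>The finitely many strict gaps below the maximum survive a small \<epsilon>, and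
  constancy of \<open>w\<close> preserves the ties at the maximum.\<close>

lemma max_bases_perturb:
  fixes \<I> :: "'a::finite set set"
  assumes ne: "max_bases \<I> u \<noteq> {}"
    and const: "\<And>B C. B \<in> max_bases \<I> u \<Longrightarrow> C \<in> max_bases \<I> u \<Longrightarrow> sum w B = sum w C"
  shows "\<forall>\<^sub>F \<epsilon> in at_right 0. max_bases \<I> (\<lambda>x. u x + \<epsilon> * w x) = max_bases \<I> u"
proof -
  let ?v = "\<lambda>\<epsilon> x. u x + \<epsilon> * w x"
  obtain B where B: "B \<in> max_bases \<I> u" using ne by blast
  have sum_v: "sum (?v \<epsilon>) C = sum u C + \<epsilon> * sum w C" for \<epsilon> C
    by (simp add: sum.distrib sum_distrib_left)
  have "\<forall>\<^sub>F \<epsilon> in at_right 0. sum (?v \<epsilon>) C < sum (?v \<epsilon>) B" if C: "C \<in> bases \<I> - max_bases \<I> u" for C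
  proof -
    have "sum u C < sum u B"
      using B C unfolding max_bases_def by (smt (verit, best) Diff_iff mem_Collect_eq)
    then have "0 < sum u B - sum u C" by simp
    moreover have "((\<lambda>\<epsilon>. sum (?v \<epsilon>) B - sum (?v \<epsilon>) C) \<longlongrightarrow> sum u B - sum u C) (at_right 0)"
      unfolding sum_v by (auto intro!: tendsto_eq_intros)
    ultimately have "\<forall>\<^sub>F \<epsilon> in at_right 0. 0 < sum (?v \<epsilon>) B - sum (?v \<epsilon>) C"
      using order_tendstoD(1) by blast
    then show ?thesis by simp
  qed
  then have "\<forall>\<^sub>F \<epsilon> in at_right 0. \<forall>C\<in>bases \<I> - max_bases \<I> u. sum (?v \<epsilon>) C < sum (?v \<epsilon>) B"
    by (intro eventually_ball_finite) auto
  then show ?thesis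
  proof eventually_elim
    case (elim \<epsilon>)
    have eq: "sum (?v \<epsilon>) C = sum (?v \<epsilon>) B" if "C \<in> max_bases \<I> u" for C
    proof -
      have "sum u C = sum u B" using B that by (auto simp: max_bases_def intro: antisym)
      then show ?thesis using const[OF that B] by (simp add: sum_v)
    qed
    have le: "sum (?v \<epsilon>) C \<le> sum (?v \<epsilon>) B" if "C \<in> bases \<I>" for C
      using eq[of C] elim that by (cases "C \<in> max_bases \<I> u") (auto intro: less_imp_le)
    show ?case
    proof (intro equalityI subsetI)
      fix C assume "C \<in> max_bases \<I> u"
      then show "C \<in> max_bases \<I> (?v \<epsilon>)"
        using le eq by (simp add: max_bases_def[of \<I> "?v \<epsilon>"] max_basesD)
    next
      fix C assume "C \<in> max_bases \<I> (?v \<epsilon>)"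
      then have "C \<in> bases \<I>" "sum (?v \<epsilon>) B \<le> sum (?v \<epsilon>) C"
        using max_basesD[OF B] by (auto simp: max_bases_def)
      moreover from this(2) have "\<not> sum (?v \<epsilon>) C < sum (?v \<epsilon>) B" by (rule leD)
      ultimately show "C \<in> max_bases \<I> u" using elim by blast
    qed
  qed
qed

section \<open>Cones indexed by weights, and their spans\<close>

lemma vec_nth_vec_lambda: "($) (\<chi> i. f i) = f"
  by (simp add: fun_eq_iff)

text \<open>Naming a cone by a weight lets sets of maximal bases stand in for faces.\<close>

definition weight_cone :: "'n::finite set set \<Rightarrow> ('n \<Rightarrow> real) \<Rightarrow> 'n mod_ones set" where
  "weight_cone \<I> u = face_cone \<I> (maximizers (matroid_polytope \<I>) (\<chi> i. u i))"

lemma weight_cone_eq: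
  "weight_cone \<I> u = closure (mod_ones_class ` {v. max_bases \<I> (($) v) = max_bases \<I> u})"
  by (simp add: weight_cone_def face_cone_def maximizers_eq_iff vec_nth_vec_lambda)

lemma mod_ones_class_in_weight_cone:
  "max_bases \<I> (($) v) = max_bases \<I> u \<Longrightarrow> mod_ones_class v \<in> weight_cone \<I> u"
  unfolding weight_cone_eq using closure_subset by fast

text \<open>Replacing \<open>x\<close> by \<open>y\<close> in a transversal through \<open>x\<close>
  gives another maximal basis, which forces equal weights at \<open>x\<close> and \<open>y\<close>.
  A closed subspace then absorbs closure and span.\<close>

lemma span_weight_cone_subset_coord_eq:
  assumes "max_bases \<I> u = transversals UNIV h" "h x = h y"
  shows "span (weight_cone \<I> u) \<subseteq> coord_eq x y"
  unfolding weight_cone_eq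
proof (intro span_minimal closure_minimal subspace_coord_eq closed_coord_eq subsetI)
  fix q assume "q \<in> mod_ones_class ` {v. max_bases \<I> (($) v) = max_bases \<I> u}"
  then obtain v where v: "q = mod_ones_class v" "max_bases \<I> (($) v) = transversals UNIV h"
    using assms by auto
  obtain B where B: "B \<in> transversals UNIV h" "x \<in> B" "insert y (B - {x}) \<in> transversals UNIV h"
    using transversal_through[of x UNIV h] assms(2) by (metis UNIV_I)
  then have "B \<in> max_bases \<I> (($) v)" "insert y (B - {x}) \<in> max_bases \<I> (($) v)"
    using v(2) by auto
  then have "sum (($) v) B = sum (($) v) (insert y (B - {x}))"
    by (auto simp: max_bases_def intro: antisym)
  moreover have "y \<notin> B \<or> y = x" using B assms(2) unfolding transversals_def by fastforce
  ultimately have "v $ x = v $ y" using sum_exchange[of B x y "($) v"] B(2) by simp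
  then show "q \<in> coord_eq x y" using v by (simp add: mod_ones_class_in_coord_eq)
qed

text \<open>Every transversal meets the fibre once, so a small multiple of its indicator can be
  added to \<open>u\<close> without changing the maximal bases. The fibre is then a multiple of a
  difference of two points of the cone.\<close>

lemma fibre_in_span_weight_cone:
  assumes "max_bases \<I> u = transversals UNIV h"
  shows "mod_ones_class (indicator_vec {y. h y = h x}) \<in> span (weight_cone \<I> u)"
proof -
  let ?e = "indicator_vec {y. h y = h x}"
  obtain B where B: "B \<in> transversals UNIV h" using transversal_through[of x UNIV h] by auto
  have "\<forall>\<^sub>F \<epsilon> in at_right 0. max_bases \<I> (\<lambda>y. u y + \<epsilon> * ?e $ y) = max_bases \<I> u"
  proof (rule max_bases_perturb)
    fix B C assume "B \<in> max_bases \<I> u" "C \<in> max_bases \<I> u"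
    then have "B \<in> transversals UNIV h" "C \<in> transversals UNIV h" using assms by auto
    then show "sum (($) ?e) B = sum (($) ?e) C"
      using transversal_sum[of _ UNIV h "($) ?e"] by (simp add: indicator_vec_nth)
  qed (use B assms in blast)
  then have "\<exists>\<epsilon>>0. max_bases \<I> (\<lambda>y. u y + \<epsilon> * ?e $ y) = max_bases \<I> u"
    using eventually_happens'[OF _ eventually_conj[OF eventually_at_right_less]] trivial_limit_at_right_real
    by (metis (mono_tags, lifting))
  then obtain \<epsilon> where \<epsilon>: "\<epsilon> > 0" "max_bases \<I> (\<lambda>y. u y + \<epsilon> * ?e $ y) = max_bases \<I> u" by blast
  let ?u = "(\<chi> i. u i) :: real ^ 'a"
  have "($) (?u + \<epsilon> *\<^sub>R ?e) = (\<lambda>y. u y + \<epsilon> * ?e $ y)" by (simp add: fun_eq_iff)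
  then have "mod_ones_class (?u + \<epsilon> *\<^sub>R ?e) \<in> weight_cone \<I> u"
    by (intro mod_ones_class_in_weight_cone) (simp only: \<epsilon>(2))
  moreover have "mod_ones_class ?u \<in> weight_cone \<I> u"
    by (intro mod_ones_class_in_weight_cone) (simp only: vec_nth_vec_lambda)
  ultimately have "mod_ones_class (?u + \<epsilon> *\<^sub>R ?e) - mod_ones_class ?u \<in> span (weight_cone \<I> u)"
    by (intro span_diff span_base)
  then have "\<epsilon> *\<^sub>R mod_ones_class ?e \<in> span (weight_cone \<I> u)"
    by (simp add: linear_add[OF linear_mod_ones_class] linear_scale[OF linear_mod_ones_class])
  then have "(1 / \<epsilon>) *\<^sub>R \<epsilon> *\<^sub>R mod_ones_class ?e \<in> span (weight_cone \<I> u)" by (rule span_scale)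
  then show ?thesis using \<epsilon>(1) by simp
qed

text \<open>Adding a positive multiple of \<open>w\<close> to a weight \<open>v\<close> with the
  maximal bases of \<open>u\<close> yields the maximal bases of \<open>w\<close>; letting the
  multiple tend to 0 puts \<open>v\<close> in the closure.\<close>

lemma weight_cone_mono:
  assumes "max_bases \<I> w \<subseteq> max_bases \<I> u" "max_bases \<I> w \<noteq> {}"
  shows "weight_cone \<I> u \<subseteq> weight_cone \<I> w"
proof -
  let ?N = "\<lambda>w. {v. max_bases \<I> (($) v) = max_bases \<I> w}"
  have "v \<in> closure (?N w)" if v: "max_bases \<I> (($) v) = max_bases \<I> u" for v
  proof -
    let ?w = "(\<chi> i. w i) :: real ^ 'a"
    have "\<forall>\<^sub>F \<epsilon> in at_right 0. v + \<epsilon> *\<^sub>R ?w \<in> ?N w"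
      using eventually_at_right_less
    proof eventually_elim
      case (elim \<epsilon>)
      \<comment> \<open>\<open>B\<close> maximizes both weights, so a basis maximizes their positive
        combination exactly when it maximizes each.\<close>
      obtain B where B: "B \<in> max_bases \<I> w" "B \<in> max_bases \<I> (($) v)" using assms v by blast
      have sum_eq: "sum (($) (v + \<epsilon> *\<^sub>R ?w)) C = sum (($) v) C + \<epsilon> * sum w C" for C
        by (simp add: sum.distrib sum_distrib_left)
      have bound: "sum (($) v) C \<le> sum (($) v) B" "\<epsilon> * sum w C \<le> \<epsilon> * sum w B"
        if "C \<in> bases \<I>" for C
        using B that elim by (auto simp: max_bases_def)
      have "C \<in> max_bases \<I> w \<longleftrightarrow> sum w B \<le> sum w C" if "C \<in> bases \<I>" for C
        using B(1) that by (force simp: max_bases_def)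
      moreover have "C \<in> max_bases \<I> (($) v) \<longleftrightarrow> sum (($) v) B \<le> sum (($) v) C" if "C \<in> bases \<I>" for C
        using B(2) that by (force simp: max_bases_def)
      moreover have "C \<in> max_bases \<I> (($) (v + \<epsilon> *\<^sub>R ?w)) \<longleftrightarrow>
          C \<in> bases \<I> \<and> sum (($) v) B + \<epsilon> * sum w B \<le> sum (($) v) C + \<epsilon> * sum w C" for C
        using bound max_basesD[OF B(1)] unfolding max_bases_def sum_eq by force
      ultimately have "C \<in> max_bases \<I> (($) (v + \<epsilon> *\<^sub>R ?w)) \<longleftrightarrow> C \<in> max_bases \<I> w" for C
        using bound[of C] elim assms(1) v max_basesD[of C \<I>]
        by (smt (verit, ccfv_SIG) mult_le_cancel_left_pos subsetD)
      then show ?case by blast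
    qed
    moreover have "((\<lambda>\<epsilon>. v + \<epsilon> *\<^sub>R ?w) \<longlongrightarrow> v) (at_right 0)"
      by (auto intro!: tendsto_eq_intros)
    moreover have "?N w \<subseteq> closure (?N w)" by (rule closure_subset)
    ultimately show ?thesis
      by (intro Lim_in_closed_set[of "closure (?N w)" _ "at_right 0"])
        (auto elim!: eventually_mono)
  qed
  then have "mod_ones_class ` ?N u \<subseteq> mod_ones_class ` closure (?N w)" by auto
  also have "\<dots> \<subseteq> weight_cone \<I> w"
    unfolding weight_cone_eq
    by (rule image_closure_subset)
      (auto intro: continuous_on_subset[OF continuous_mod_ones_class] simp: closure_subset)
  finally show ?thesis
    unfolding weight_cone_eq by (simp add: closure_minimal)
qed

section \<open>Recovering a maximal cone from its span\<close>

lemma maximal_cone_transversal: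
  fixes \<I> :: "'n::finite set set"
  assumes M: "matroid UNIV \<I>" and C: "C \<in> maximal_cones \<I>" "C \<noteq> {}"
  obtains h :: "'n \<Rightarrow> nat" where
    "max_bases \<I> (\<lambda>x. real (h x)) = transversals UNIV h" "C = weight_cone \<I> (\<lambda>x. real (h x))"
proof -
  obtain S where S: "C = face_cone \<I> S" "loopfree UNIV (degeneration \<I> S)"
    using C by (auto simp: maximal_cones_def bergman_fan_def)
  \<comment> \<open>Nonemptiness of \<open>C\<close> provides a weight that is maximal exactly on
    \<open>S\<close>.\<close>
  then obtain u where u: "maximizers (matroid_polytope \<I>) u = S"
    using C(2) by (fastforce simp: face_cone_def)
  then have "\<exists>B\<in>max_bases \<I> (($) u). x \<in> B" for x
    using S(2) bases_degeneration[of \<I> u] by (simp add: loopfree_def)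
  then obtain h :: "'n \<Rightarrow> nat" where h: "max_bases \<I> (\<lambda>x. real (h x)) = transversals UNIV h"
    "transversals UNIV h \<subseteq> max_bases \<I> (($) u)"
    using transversal_refinement[OF M, of "($) u"] by auto
  let ?h = "\<lambda>x. real (h x)"
  let ?S = "maximizers (matroid_polytope \<I>) (\<chi> i. ?h i)"
  have cover: "\<exists>B\<in>max_bases \<I> ?h. x \<in> B" for x
    using transversal_through[of x UNIV h] h by (metis UNIV_I)
  have "?S face_of matroid_polytope \<I>"
    by (intro maximizers_face_of) (simp add: matroid_polytope_def)
  moreover have "loopfree UNIV (degeneration \<I> ?S)"
    using cover by (simp add: loopfree_def bases_degeneration vec_nth_vec_lambda)
  ultimately have "weight_cone \<I> ?h \<in> bergman_fan \<I>"
    unfolding bergman_fan_def weight_cone_def by blast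
  moreover have "C \<subseteq> weight_cone \<I> ?h"
  proof -
    have "C = weight_cone \<I> (($) u)" using S u by (simp add: weight_cone_def)
    then show ?thesis using weight_cone_mono[of \<I> ?h "($) u"] h cover by blast
  qed
  ultimately have "C = weight_cone \<I> ?h" using C by (auto simp: maximal_cones_def)
  with h show thesis using that by blast
qed

text \<open>The indicator of the \<open>h\<close>-fibre of \<open>x\<close> lies in the larger span,
  hence has equal coordinates at \<open>x\<close> and \<open>y\<close>; so \<open>y\<close> belongs
  to that fibre.\<close>

lemma fibres_finer_if_span_subset:
  fixes u w :: "'n::finite \<Rightarrow> real"
  assumes "max_bases \<I> u = transversals UNIV h" "max_bases \<I> w = transversals UNIV k"
    and "span (weight_cone \<I> u) \<subseteq> span (weight_cone \<I> w)" "k x = k y"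
  shows "h x = h y"
proof -
  have "mod_ones_class (indicator_vec {z. h z = h x}) \<in> coord_eq x y"
    using fibre_in_span_weight_cone[OF assms(1)] span_weight_cone_subset_coord_eq[OF assms(2,4)]
      assms(3) by blast
  then show ?thesis
    by (simp add: mod_ones_class_in_coord_eq indicator_vec_nth split: if_splits)
qed

theorem theorem4p2:
  fixes \<I> :: "'n::finite set set"
    and C D :: "'n mod_ones set"
  assumes "matroid UNIV \<I>"
    and "loopfree UNIV \<I>"
    and "C \<in> maximal_cones \<I>"
    and "D \<in> maximal_cones \<I>"
    and "C \<noteq> D"
  shows "span C \<noteq> span D"
proof
  assume span: "span C = span D"
  \<comment> \<open>An empty maximal cone would be contained in the other one and hence equal to
    it.\<close>
  have "C \<noteq> {}" "D \<noteq> {}" using assms(3-5) by (auto simp: maximal_cones_def)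
  obtain h :: "'n \<Rightarrow> nat" where h: "max_bases \<I> (\<lambda>x. real (h x)) = transversals UNIV h"
    "C = weight_cone \<I> (\<lambda>x. real (h x))"
    using maximal_cone_transversal[OF assms(1,3) \<open>C \<noteq> {}\<close>] .
  obtain k :: "'n \<Rightarrow> nat" where k: "max_bases \<I> (\<lambda>x. real (k x)) = transversals UNIV k"
    "D = weight_cone \<I> (\<lambda>x. real (k x))"
    using maximal_cone_transversal[OF assms(1,4) \<open>D \<noteq> {}\<close>] .
  have "h x = h y \<longleftrightarrow> k x = k y" for x y
    using fibres_finer_if_span_subset[OF h(1) k(1)] fibres_finer_if_span_subset[OF k(1) h(1)]
      span h(2) k(2) by blast
  then have "transversals UNIV h = transversals UNIV k" by (simp add: transversals_def)
  then have "C = D" using h k by (simp add: weight_cone_eq)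
  then show False using assms(5) by contradiction
qed

end
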